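(* Let $k,z,n,v,d,\alpha,\beta,r$ be positive integers such that $z\mid k$, $k\mid n+v$, $\alpha+\beta=\frac{k}{z}dv$, and $$\operatorname{lcm}(\alpha,\beta)=\frac{dn\left(\frac{n+v}{z}\right)}{r}.$$ Then $$\frac{k}{n}=\frac{1}{\frac{n+v}{k}}+\frac{1}{\frac{dn(n+v)}{z\alpha}}+\frac{1}{\frac{dn(n+v)}{z\beta}},$$ and the three denominators $\frac{n+v}{k}$, $\frac{dn(n+v)}{z\alpha}$, $\frac{dn(n+v)}{z\beta}$ are positive integers.
   Context: The result gives a "well-defined equation" for the problem of writing $\frac{k}{n}=\frac1x+\frac1y+\frac1u$ with positive integers $x,y,u$, i.e. an explicit parametrized representation as a sum of unit fractions. *)

theory Defs
  imports Complex_Main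
begin

end

theory Submission
  imports Defs
begin

text \<open>
  Partial fractions give
  \<open>k/n = k/(n + v) + k v/(n (n + v))\<close>, and the first summand is already a unit fraction because
  \<open>k\<close> divides \<open>n + v\<close>.  Expanding the second summand by \<open>d\<close> puts
  \<open>k d v/z = \<alpha> + \<beta>\<close> into its numerator, over the denominator \<open>D = d n (n + v)/z\<close>, so it splits as
  \<open>\<alpha>/D + \<beta>/D\<close>.  Both of these are unit fractions because the hypothesis on the least
  common multiple says that \<open>D = r lcm(\<alpha>, \<beta>)\<close>, whence \<open>\<alpha>\<close> and \<open>\<beta>\<close> both divide \<open>D\<close>.
\<close>

text \<open>
  The last two fractions have the common denominator \<open>d n (n + v)\<close>; putting the value of \<open>a + b\<close>
  into their sum cancels \<open>d\<close> and \<open>z\<close>, and what is left is the difference of \<open>k/n\<close> and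
  \<open>k/(n + v)\<close>.
\<close>

lemma three_fraction_split:
  fixes k z n v d a b :: "'a :: field"
  assumes nz: "n \<noteq> 0" "n + v \<noteq> 0" "d \<noteq> 0" "z \<noteq> 0"
    and sum: "a + b = k / z * d * v"
  shows "k / n = 1 / ((n + v) / k) + 1 / (d * n * (n + v) / (z * a))
                 + 1 / (d * n * (n + v) / (z * b))"
proof -
  have "1 / (d * n * (n + v) / (z * a)) + 1 / (d * n * (n + v) / (z * b))
        = z * (a + b) / (d * n * (n + v))"
    by (simp add: add_divide_distrib distrib_left[of z])
  also have "\<dots> = k * v / (n * (n + v))"
    using nz by (simp add: sum)
  finally have "1 / (d * n * (n + v) / (z * a)) + 1 / (d * n * (n + v) / (z * b))
                = k * v / (n * (n + v))" .
  moreover have "k / n = k / (n + v) + k * v / (n * (n + v))"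
    using nz by (simp add: divide_simps) (simp add: algebra_simps)
  ultimately show ?thesis
    by (simp add: add.assoc)
qed

lemma of_nat_divide_in_Ints:
  assumes "a dvd b"
  shows "(of_nat b / of_nat a :: 'a :: field_char_0) \<in> \<int>"
  using assms by (cases "a = 0") auto

theorem theorem4p4:
  fixes k z n v d \<alpha> \<beta> r :: nat
  assumes "k > 0" and "z > 0" and "n > 0" and "v > 0"
    and "d > 0" and "\<alpha> > 0" and "\<beta> > 0" and "r > 0"
    and "z dvd k" and "k dvd n + v"
    and "real (\<alpha> + \<beta>) = real k / real z * real d * real v"
    and "real (lcm \<alpha> \<beta>) = real d * real n * (real (n + v) / real z) / real r"
  shows "real k / real n =
           1 / (real (n + v) / real k)
         + 1 / (real d * real n * real (n + v) / (real z * real \<alpha>))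
         + 1 / (real d * real n * real (n + v) / (real z * real \<beta>))
       \<and> real (n + v) / real k \<in> \<int>
       \<and> real (n + v) / real k > 0
       \<and> real d * real n * real (n + v) / (real z * real \<alpha>) \<in> \<int>
       \<and> real d * real n * real (n + v) / (real z * real \<alpha>) > 0
       \<and> real d * real n * real (n + v) / (real z * real \<beta>) \<in> \<int>
       \<and> real d * real n * real (n + v) / (real z * real \<beta>) > 0"
proof -
  note pos = assms(1-8)
  have D: "real d * real n * real (n + v) / real z = real (r * lcm \<alpha> \<beta>)"
    using assms(12) pos by simp
  have "real d * real n * real (n + v) / (real z * real x) \<in> \<int>" if "x dvd lcm \<alpha> \<beta>" for x
  proof -
    have "real d * real n * real (n + v) / (real z * real x) = real (r * lcm \<alpha> \<beta>) / real x"
      unfolding D[symmetric] by simp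
    then show ?thesis
      using of_nat_divide_in_Ints[OF dvd_mult[OF that, of r], where ?'a = real] by simp
  qed
  then have "real d * real n * real (n + v) / (real z * real \<alpha>) \<in> \<int>"
    and "real d * real n * real (n + v) / (real z * real \<beta>) \<in> \<int>"
    by simp_all
  moreover have "real k / real n =
           1 / (real (n + v) / real k)
         + 1 / (real d * real n * real (n + v) / (real z * real \<alpha>))
         + 1 / (real d * real n * real (n + v) / (real z * real \<beta>))"
    using three_fraction_split[of "real n" "real v" "real d" "real z" "real \<alpha>" "real \<beta>" "real k"]
      assms(11) pos by simp
  moreover have "real (n + v) / real k \<in> \<int>"
    using of_nat_divide_in_Ints[OF \<open>k dvd n + v\<close>] .
  ultimately show ?thesis
    using pos by simp
qed

end
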